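(* (Subdivision algorithm.) Let $P_k$, $k=0,\ldots,n$, be the control points of an $h$--$\gamma$ B\'ezier curve $G\in\pi_n(\gamma_1,\gamma_2)$ over the interval $[a,b]$, and let $t\in[a,b]$, where each of the pairs $(\alpha,\beta)=(a,b),(a,t),(t,b)$ satisfies $d(\alpha-jh,\beta-ih)\ne0$ for $0\le i\le j\le n-1$. Then the control points for the restriction of $G(x)$ to the subintervals $[a,t]$ and $[t,b]$ are given respectively by $$L_k=P_0^k(t)\quad\text{and}\quad R_k=P_k^{n-k}(t),\qquad k=0,\ldots,n,$$ where $P_0^k(t)$ are the intermediate points of the evaluation algorithm for $G(x)$ with $\sigma(i)=i$ and $P_k^{n-k}(t)$ are the intermediate points of the evaluation algorithm for $G(x)$ with $\sigma(i)=n+1-i$, evaluated at $x=t$.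
   Context: Let $n\ge 1$ be an integer and $h\in\mathbb R$ fixed. Let $\gamma_1,\gamma_2:\mathbb R\to\mathbb R$ be continuous, linearly independent functions. They are assumed translation invariant: for every $s\in\mathbb R$ there is an invertible $2\times2$ matrix $C(s)$ with $\begin{pmatrix}\gamma_1(x-s)\\ \gamma_2(x-s)\end{pmatrix}=C(s)\begin{pmatrix}\gamma_1(x)\\ \gamma_2(x)\end{pmatrix}$ for all $x$. Put $\pi_n(\gamma_1,\gamma_2)=\mathrm{span}\{\gamma_1^{n-k}\gamma_2^{k}\}_{k=0}^n$ and $d(u,v)=\gamma_1(u)\gamma_2(v)-\gamma_2(u)\gamma_1(v)$. For $0\le k\le n$ put $G_{n,k}(t;h)=\sum_{I\subseteq\{1,\ldots,n\},\,|I|=k}\ \prod_{i\in I}\gamma_1(t-(i-1)h)\prod_{i\in\{1,\ldots,n\}\setminus I}\gamma_2(t-(i-1)h)$. Standing assumption: $h$ is such that the functions $t\mapsto G_{n,k}(t;h)$, $k=0,\ldots,n$, are linearly independent. Evaluation algorithm: for a permutation $\sigma$ of $\{1,\ldots,n\}$, endpoints $\alpha,\beta$ with $d(\alpha-jh,\beta-ih)\ne0$ for $0\le i\le j\le n-1$, and initial values $P_0^0,\ldots,P_n^0$, define for $0\le i\le n-k-1$, $0\le k\le n-1$ $$P_i^{k+1}(x)=\frac{d(x-(\sigma(k+1)-1)h,\,\beta-ih)}{d(\alpha-(i+k)h,\,\beta-ih)}P_i^k(x)+\frac{d(\alpha-(i+k)h,\,x-(\sigma(k+1)-1)h)}{d(\alpha-(i+k)h,\,\beta-ih)}P_{i+1}^k(x).$$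 The $h$--$\gamma$ Bernstein basis function $B_k^n(x,[\alpha,\beta];\gamma,h)$ is the coefficient of $P_k^0$ in $P_0^n(x)$ for $\sigma=\mathrm{id}$: $P_0^n(x)=\sum_{k=0}^nP_k^0B_k^n(x,[\alpha,\beta];\gamma,h)$. The control points of $G$ over $[\alpha,\beta]$ are the coefficients $b_k$ in $G(x)=\sum_{k=0}^nb_kB_k^n(x,[\alpha,\beta];\gamma,h)$. The evaluation algorithm for $G(x)$ over $[a,b]$ with permutation $\sigma$ is the recursion $$P_i^{k+1}(x)=\frac{d(x-(\sigma(k+1)-1)h,\,b-ih)}{d(a-(i+k)h,\,b-ih)}P_i^k(x)+\frac{d(a-(i+k)h,\,x-(\sigma(k+1)-1)h)}{d(a-(i+k)h,\,b-ih)}P_{i+1}^k(x),\qquad 0\le i\le n-k-1,\ 0\le k\le n-1,$$ with initial values $P_i^0=P_i$, $i=0,\ldots,n$, the control points of $G$ over $[a,b]$. Intervals $[\alpha,\beta]$ are those determined by their endpoints in either order. *)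

theory Defs
  imports "HOL-Analysis.Analysis"
begin

definition lin_indep_fns :: "'i set \<Rightarrow> ('i \<Rightarrow> real \<Rightarrow> real) \<Rightarrow> bool" where
  "lin_indep_fns I f \<longleftrightarrow>
     (\<forall>c. (\<forall>x. (\<Sum>i\<in>I. c i * f i x) = 0) \<longrightarrow> (\<forall>i\<in>I. c i = 0))"

definition translation_invariant :: "(real \<Rightarrow> real) \<Rightarrow> (real \<Rightarrow> real) \<Rightarrow> bool" where
  "translation_invariant \<gamma>1 \<gamma>2 \<longleftrightarrow>
     (\<forall>s. \<exists>C :: real^2^2. invertible C \<and>
        (\<forall>x. vector [\<gamma>1 (x - s), \<gamma>2 (x - s)] = C *v vector [\<gamma>1 x, \<gamma>2 x]))"

text \<open>The space \<open>\<pi>\<^sub>n(\<gamma>\<^sub>1, \<gamma>\<^sub>2)\<close>, for curves with values in a real vector space: the coefficients of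
  the spanning functions are vectors. For real-valued functions this is the linear span.\<close>

definition pi_space ::
  "(real \<Rightarrow> real) \<Rightarrow> (real \<Rightarrow> real) \<Rightarrow> nat \<Rightarrow> (real \<Rightarrow> 'a::real_vector) set" where
  "pi_space \<gamma>1 \<gamma>2 n =
     {G. \<exists>c. \<forall>x. G x = (\<Sum>k\<le>n. (\<gamma>1 x ^ (n - k) * \<gamma>2 x ^ k) *\<^sub>R c k)}"

definition dgam :: "(real \<Rightarrow> real) \<Rightarrow> (real \<Rightarrow> real) \<Rightarrow> real \<Rightarrow> real \<Rightarrow> real" where
  "dgam \<gamma>1 \<gamma>2 u v = \<gamma>1 u * \<gamma>2 v - \<gamma>2 u * \<gamma>1 v"

definition Gfun ::
  "(real \<Rightarrow> real) \<Rightarrow> (real \<Rightarrow> real) \<Rightarrow> real \<Rightarrow> nat \<Rightarrow> nat \<Rightarrow> real \<Rightarrow> real" where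
  "Gfun \<gamma>1 \<gamma>2 h n k t =
     (\<Sum>I | I \<subseteq> {1..n} \<and> card I = k.
        (\<Prod>i\<in>I. \<gamma>1 (t - (real i - 1) * h)) * (\<Prod>i\<in>{1..n} - I. \<gamma>2 (t - (real i - 1) * h)))"

definition admissible ::
  "(real \<Rightarrow> real) \<Rightarrow> (real \<Rightarrow> real) \<Rightarrow> real \<Rightarrow> nat \<Rightarrow> real \<Rightarrow> real \<Rightarrow> bool" where
  "admissible \<gamma>1 \<gamma>2 h n \<alpha> \<beta> \<longleftrightarrow>
     (\<forall>i j. i \<le> j \<and> j < n \<longrightarrow> dgam \<gamma>1 \<gamma>2 (\<alpha> - real j * h) (\<beta> - real i * h) \<noteq> 0)"

text \<open>\<open>hg_eval \<gamma>1 \<gamma>2 h \<alpha> \<beta> \<sigma> P x k i\<close> is the intermediate value \<open>P\<^sub>i\<^sup>k(x)\<close> with \<open>P\<^sub>i\<^sup>0 = P i\<close>. In degree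
  \<open>n\<close> only the values with \<open>i + k \<le> n\<close> are meaningful; they depend only on \<open>P 0, \<dots>, P n\<close> and on
  \<open>\<sigma>\<close> restricted to \<open>{1..n}\<close>.\<close>

primrec hg_eval ::
  "(real \<Rightarrow> real) \<Rightarrow> (real \<Rightarrow> real) \<Rightarrow> real \<Rightarrow> real \<Rightarrow> real \<Rightarrow> (nat \<Rightarrow> nat) \<Rightarrow>
   (nat \<Rightarrow> 'a::real_vector) \<Rightarrow> real \<Rightarrow> nat \<Rightarrow> nat \<Rightarrow> 'a" where
  "hg_eval \<gamma>1 \<gamma>2 h \<alpha> \<beta> \<sigma> P x 0 = P"
| "hg_eval \<gamma>1 \<gamma>2 h \<alpha> \<beta> \<sigma> P x (Suc k) = (\<lambda>i.
     (dgam \<gamma>1 \<gamma>2 (x - (real (\<sigma> (k + 1)) - 1) * h) (\<beta> - real i * h) /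
      dgam \<gamma>1 \<gamma>2 (\<alpha> - real (i + k) * h) (\<beta> - real i * h)) *\<^sub>R hg_eval \<gamma>1 \<gamma>2 h \<alpha> \<beta> \<sigma> P x k i +
     (dgam \<gamma>1 \<gamma>2 (\<alpha> - real (i + k) * h) (x - (real (\<sigma> (k + 1)) - 1) * h) /
      dgam \<gamma>1 \<gamma>2 (\<alpha> - real (i + k) * h) (\<beta> - real i * h)) *\<^sub>R hg_eval \<gamma>1 \<gamma>2 h \<alpha> \<beta> \<sigma> P x k (i + 1))"

text \<open>The coefficient of \<open>P\<^sub>k\<^sup>0\<close> in \<open>P\<^sub>0\<^sup>n(x)\<close> is obtained by running the algorithm, which is linear in
  the initial values, on the \<open>k\<close>-th unit sequence; see \<open>hg_eval_eq_sum_bernstein\<close>.\<close>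

definition hg_bernstein ::
  "(real \<Rightarrow> real) \<Rightarrow> (real \<Rightarrow> real) \<Rightarrow> real \<Rightarrow> nat \<Rightarrow> real \<Rightarrow> real \<Rightarrow> nat \<Rightarrow> real \<Rightarrow> real" where
  "hg_bernstein \<gamma>1 \<gamma>2 h n \<alpha> \<beta> k x =
     hg_eval \<gamma>1 \<gamma>2 h \<alpha> \<beta> (\<lambda>i. i) (\<lambda>i. if i = k then 1 else 0) x n 0"

lemma hg_eval_linear:
  assumes "i + k \<le> n"
  shows "hg_eval \<gamma>1 \<gamma>2 h \<alpha> \<beta> \<sigma> P x k i =
    (\<Sum>l\<le>n. hg_eval \<gamma>1 \<gamma>2 h \<alpha> \<beta> \<sigma> (\<lambda>j. if j = l then 1 else 0 :: real) x k i *\<^sub>R P l)"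
  using assms
proof (induction k arbitrary: i)
  case 0
  have "(\<Sum>l\<le>n. (if i = l then 1 else 0 :: real) *\<^sub>R P l) = (\<Sum>l\<le>n. if i = l then P l else 0)"
    by (intro sum.cong) auto
  with 0 show ?case by simp
next
  case (Suc k)
  show ?case
    using Suc.IH[of i] Suc.IH[of "i + 1"] Suc.prems
    by (simp add: scaleR_add_left sum.distrib scaleR_sum_right)
qed

lemma hg_eval_eq_sum_bernstein:
  "hg_eval \<gamma>1 \<gamma>2 h \<alpha> \<beta> (\<lambda>i. i) P x n 0 = (\<Sum>k\<le>n. hg_bernstein \<gamma>1 \<gamma>2 h n \<alpha> \<beta> k x *\<^sub>R P k)"
  unfolding hg_bernstein_def by (rule hg_eval_linear) simp

text \<open>Only \<open>b 0, \<dots>, b n\<close> matter. Elements of \<open>\<pi>\<^sub>n\<close> are functions on the whole line, and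
  the identity is required there.\<close>

definition control_points ::
  "(real \<Rightarrow> real) \<Rightarrow> (real \<Rightarrow> real) \<Rightarrow> real \<Rightarrow> nat \<Rightarrow> real \<Rightarrow> real \<Rightarrow>
   (real \<Rightarrow> 'a::real_vector) \<Rightarrow> (nat \<Rightarrow> 'a) \<Rightarrow> bool" where
  "control_points \<gamma>1 \<gamma>2 h n \<alpha> \<beta> G b \<longleftrightarrow>
     (\<forall>x. G x = (\<Sum>k\<le>n. hg_bernstein \<gamma>1 \<gamma>2 h n \<alpha> \<beta> k x *\<^sub>R b k))"

end

theory Submission
  imports Defs "HOL-Computational_Algebra.Polynomial"
begin

text \<open>A coefficient family \<open>c\<close> defines the linear functional \<open>\<Sum>k\<le>n. coeff q k *\<^sub>R c k\<close> on
  polynomials of degree at most \<open>n\<close>. Composed with \<open>(u\<^sub>1, \<dots>, u\<^sub>n) \<mapsto> \<Prod>i. [:\<gamma>\<^sub>2 u\<^sub>i, \<gamma>\<^sub>1 u\<^sub>i:]\<close>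
  it is the blossom: symmetric because multiplication of polynomials is commutative, and
  linear in each factor, so that Cramer's rule in the plane drives the evaluation algorithm. Linear
  independence of the \<open>G\<^sub>n\<^sub>,\<^sub>k\<close> makes blossom values at the nodes of any admissible interval
  determine \<open>c\<close> and take arbitrary values. Hence the control points of a curve over such an
  interval are exactly the blossom values at its nodes, and the intermediate points of the evaluation
  algorithm over \<open>[a, b]\<close> at \<open>t\<close> with the two permutations are blossom values at the nodes of
  \<open>[a, t]\<close> and \<open>[t, b]\<close>.\<close>

section \<open>Linear algebra with vector-valued unknowns\<close>

text \<open>Gaussian elimination on the column \<open>k\<^sub>0\<close> with pivot row \<open>j\<^sub>0\<close>.\<close>

lemma square_system_solvable:
  fixes M :: "'j \<Rightarrow> 'k \<Rightarrow> real" and p :: "'j \<Rightarrow> 'a::real_vector"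
  assumes "finite K" "finite J" "card J = card K"
    and "\<And>c. (\<And>j. j \<in> J \<Longrightarrow> (\<Sum>k\<in>K. M j k * c k) = 0) \<Longrightarrow> \<forall>k\<in>K. c k = 0"
  shows "\<exists>c. \<forall>j\<in>J. (\<Sum>k\<in>K. M j k *\<^sub>R c k) = p j"
  using assms
proof (induction K arbitrary: J M p rule: finite_induct)
  case empty
  then show ?case by simp
next
  case (insert k0 K)
  \<comment> \<open>Without a pivot, the unit vector at \<open>k0\<close> would be a nonzero kernel
    element.\<close>
  have "\<exists>j0\<in>J. M j0 k0 \<noteq> 0"
  proof (rule ccontr)
    assume "\<not> ?thesis"
    then have "(\<Sum>k\<in>insert k0 K. M j k * (if k = k0 then 1 else 0)) = 0" if "j \<in> J" for j
      using that by (intro sum.neutral) auto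
    then show False using insert.prems(3)[of "\<lambda>k. if k = k0 then 1 else 0"] by auto
  qed
  then obtain j0 where j0: "j0 \<in> J" "M j0 k0 \<noteq> 0" by blast
  define r where "r j = M j k0 / M j0 k0" for j
  have r: "r j * M j0 k0 = M j k0" for j using j0 by (simp add: r_def)
  define M' where "M' j k = M j k - r j * M j0 k" for j k
  have "\<exists>c. \<forall>j\<in>J - {j0}. (\<Sum>k\<in>K. M' j k *\<^sub>R c k) = p j - r j *\<^sub>R p j0"
  proof (rule insert.IH)
    show "finite (J - {j0})" "card (J - {j0}) = card K"
      using insert.prems insert.hyps j0 by auto
    fix c assume c: "\<And>j. j \<in> J - {j0} \<Longrightarrow> (\<Sum>k\<in>K. M' j k * c k) = 0"
    define s where "s = (\<Sum>k\<in>K. M j0 k * c k)"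
    \<comment> \<open>A kernel vector of the reduced system extends to the full one: row
      \<open>j0\<close> dictates its entry at \<open>k0\<close>.\<close>
    define c' where "c' k = (if k = k0 then - s / M j0 k0 else c k)" for k
    have eq: "(\<Sum>k\<in>insert k0 K. M j k * c' k) = - r j * s + (\<Sum>k\<in>K. M j k * c k)" for j
    proof -
      have "(\<Sum>k\<in>K. M j k * c' k) = (\<Sum>k\<in>K. M j k * c k)"
        using insert.hyps by (intro sum.cong) (auto simp: c'_def)
      then show ?thesis using insert.hyps by (simp add: c'_def r_def)
    qed
    have "(\<Sum>k\<in>insert k0 K. M j k * c' k) = 0" if "j \<in> J" for j
    proof (cases "j = j0")
      case True
      then show ?thesis using j0 unfolding eq by (simp add: r_def s_def)
    next
      case False
      then have "(\<Sum>k\<in>K. M' j k * c k) = 0" using c that by simp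
      then show ?thesis unfolding eq
        by (simp add: M'_def s_def left_diff_distrib sum_subtractf sum_distrib_left mult.assoc
            sum_negf)
    qed
    then have "\<forall>k\<in>insert k0 K. c' k = 0" by (rule insert.prems(3))
    then show "\<forall>k\<in>K. c k = 0" using insert.hyps by (auto simp: c'_def split: if_splits)
  qed
  then obtain c where c: "(\<Sum>k\<in>K. M' j k *\<^sub>R c k) = p j - r j *\<^sub>R p j0" if "j \<in> J" "j \<noteq> j0" for j
    by auto
  define s where "s = (\<Sum>k\<in>K. M j0 k *\<^sub>R c k)"
  \<comment> \<open>Back substitution: the entry at \<open>k0\<close> comes from solving row
    \<open>j0\<close>.\<close>
  define c' where "c' k = (if k = k0 then (1 / M j0 k0) *\<^sub>R (p j0 - s) else c k)" for k
  have eq: "(\<Sum>k\<in>insert k0 K. M j k *\<^sub>R c' k) = r j *\<^sub>R (p j0 - s) + (\<Sum>k\<in>K. M j k *\<^sub>R c k)" for j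
  proof -
    have "(\<Sum>k\<in>K. M j k *\<^sub>R c' k) = (\<Sum>k\<in>K. M j k *\<^sub>R c k)"
      using insert.hyps by (intro sum.cong) (auto simp: c'_def)
    then show ?thesis using insert.hyps by (simp add: c'_def r_def)
  qed
  have "(\<Sum>k\<in>insert k0 K. M j k *\<^sub>R c' k) = p j" if "j \<in> J" for j
  proof (cases "j = j0")
    case True
    then show ?thesis using j0 unfolding eq by (simp add: r_def s_def)
  next
    case False
    have "(\<Sum>k\<in>K. M' j k *\<^sub>R c k) = (\<Sum>k\<in>K. M j k *\<^sub>R c k) - r j *\<^sub>R s"
      by (simp add: M'_def s_def scaleR_left_diff_distrib sum_subtractf scaleR_sum_right)
    then show ?thesis using c[OF that False] unfolding eq by (simp add: algebra_simps)
  qed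
  then show ?case by blast
qed

text \<open>Independence is given for real coefficients; inner products with the basis vectors
  transfer it to vector coefficients.\<close>

lemma lin_indep_fns_vector:
  fixes c :: "'i \<Rightarrow> 'a::euclidean_space"
  assumes "lin_indep_fns I f" "\<And>x. (\<Sum>i\<in>I. f i x *\<^sub>R c i) = 0" "i \<in> I"
  shows "c i = 0"
proof (rule euclidean_eqI)
  fix e :: 'a
  assume "e \<in> Basis"
  have "(\<Sum>i\<in>I. (c i \<bullet> e) * f i x) = 0" for x
    using arg_cong[OF assms(2)[of x], of "\<lambda>v. v \<bullet> e"]
    by (simp add: inner_sum_left mult.commute)
  with assms(1,3) show "c i \<bullet> e = 0 \<bullet> e"
    unfolding lin_indep_fns_def by (metis inner_zero_left)
qed

section \<open>Products of linear factors and functionals on them\<close>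

text \<open>The indeterminate marks the choice of \<gamma>1, so the degree in an expanded product is
  the size of the set \<open>I\<close> in \<open>Gfun\<close>.\<close>

definition gamma_factor :: "(real \<Rightarrow> real) \<Rightarrow> (real \<Rightarrow> real) \<Rightarrow> real \<Rightarrow> real poly" where
  "gamma_factor \<gamma>1 \<gamma>2 u = [:\<gamma>2 u, \<gamma>1 u:]"

definition coeff_functional :: "nat \<Rightarrow> (nat \<Rightarrow> 'a::real_vector) \<Rightarrow> real poly \<Rightarrow> 'a" where
  "coeff_functional n c q = (\<Sum>k\<le>n. coeff q k *\<^sub>R c k)"

definition node_prod ::
  "(real \<Rightarrow> real) \<Rightarrow> (real \<Rightarrow> real) \<Rightarrow> real \<Rightarrow> nat set \<Rightarrow> real \<Rightarrow> real poly" where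
  "node_prod \<gamma>1 \<gamma>2 h S u = (\<Prod>l\<in>S. gamma_factor \<gamma>1 \<gamma>2 (u - real l * h))"

lemma coeff_functional_add:
  "coeff_functional n c (p + q) = coeff_functional n c p + coeff_functional n c q"
  by (simp add: coeff_functional_def scaleR_add_left sum.distrib)

lemma coeff_functional_smult:
  "coeff_functional n c (smult r q) = r *\<^sub>R coeff_functional n c q"
  by (simp add: coeff_functional_def scaleR_sum_right)

text \<open>Three vectors in the plane satisfy a linear relation whose coefficients are their 2x2
  determinants. The weights are those of one step of \<open>hg_eval\<close>.\<close>

lemma gamma_factor_cramer:
  assumes "dgam \<gamma>1 \<gamma>2 u v \<noteq> 0"
  shows "gamma_factor \<gamma>1 \<gamma>2 y =
    smult (dgam \<gamma>1 \<gamma>2 y v / dgam \<gamma>1 \<gamma>2 u v) (gamma_factor \<gamma>1 \<gamma>2 u) +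
    smult (dgam \<gamma>1 \<gamma>2 u y / dgam \<gamma>1 \<gamma>2 u v) (gamma_factor \<gamma>1 \<gamma>2 v)"
proof -
  have "dgam \<gamma>1 \<gamma>2 y v / dgam \<gamma>1 \<gamma>2 u v * g u + dgam \<gamma>1 \<gamma>2 u y / dgam \<gamma>1 \<gamma>2 u v * g v = g y"
    if "g = \<gamma>1 \<or> g = \<gamma>2" for g
    using assms that by (auto simp: divide_simps) (auto simp: dgam_def algebra_simps)
  then show ?thesis by (simp add: gamma_factor_def)
qed

text \<open>Makes the curve of a functional the combination of the
  \<open>Gfun \<gamma>1 \<gamma>2 h n k\<close> with coefficients \<open>c k\<close>, to which the
  independence assumption applies.\<close>

lemma coeff_node_prod:
  "coeff (node_prod \<gamma>1 \<gamma>2 h {..<n} x) k = Gfun \<gamma>1 \<gamma>2 h n k x"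
proof -
  let ?f = "\<lambda>i. \<gamma>1 (x - (real i - 1) * h)" and ?g = "\<lambda>i. \<gamma>2 (x - (real i - 1) * h)"
  have "node_prod \<gamma>1 \<gamma>2 h {..<n} x = (\<Prod>i\<in>{1..n}. monom (?f i) 1 + [:?g i:])"
    unfolding node_prod_def
    \<comment> \<open>Nodes count from 0, the indices in \<open>Gfun\<close> from 1.\<close>
    by (rule prod.reindex_bij_witness[of _ "\<lambda>i. i - 1" Suc])
       (auto simp: gamma_factor_def monom_altdef)
  also have "\<dots> = (\<Sum>I\<in>Pow {1..n}. (\<Prod>i\<in>I. monom (?f i) 1) * (\<Prod>i\<in>{1..n} - I. [:?g i:]))"
    by (rule prod_add) simp
  also have "\<dots> = (\<Sum>I\<in>Pow {1..n}. monom ((\<Prod>i\<in>I. ?f i) * (\<Prod>i\<in>{1..n} - I. ?g i)) (card I))"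
  proof (rule sum.cong)
    fix I assume "I \<in> Pow {1..n}"
    then have "finite I" using finite_subset by auto
    then have "(\<Prod>i\<in>I. monom (?f i) 1) = monom (\<Prod>i\<in>I. ?f i) (card I)"
      by (induction I rule: finite_induct) (simp_all add: mult_monom)
    moreover have "(\<Prod>i\<in>A. [:?g i:]) = monom (\<Prod>i\<in>A. ?g i) 0" if "finite A" for A
      using that by (induction A rule: finite_induct) (simp_all add: monom_0)
    ultimately show "(\<Prod>i\<in>I. monom (?f i) 1) * (\<Prod>i\<in>{1..n} - I. [:?g i:]) =
        monom ((\<Prod>i\<in>I. ?f i) * (\<Prod>i\<in>{1..n} - I. ?g i)) (card I)"
      by (simp add: mult_monom)
  qed simp
  also have "coeff \<dots> k = (\<Sum>I\<in>Pow {1..n}.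
      if card I = k then (\<Prod>i\<in>I. ?f i) * (\<Prod>i\<in>{1..n} - I. ?g i) else 0)"
    unfolding coeff_sum coeff_monom ..
  also have "\<dots> = (\<Sum>I | I \<in> Pow {1..n} \<and> card I = k.
      (\<Prod>i\<in>I. ?f i) * (\<Prod>i\<in>{1..n} - I. ?g i))"
    by (rule sum.inter_filter[symmetric]) simp
  also have "\<dots> = Gfun \<gamma>1 \<gamma>2 h n k x"
    unfolding Gfun_def Pow_iff ..
  finally show ?thesis .
qed

section \<open>The evaluation algorithm in terms of nodes\<close>

text \<open>From \<open>i\<close> to \<open>i + 1\<close> the node \<alpha> - ih is exchanged for
  \<beta> - ih.\<close>

definition interval_prod ::
  "(real \<Rightarrow> real) \<Rightarrow> (real \<Rightarrow> real) \<Rightarrow> real \<Rightarrow> nat \<Rightarrow> real \<Rightarrow> real \<Rightarrow> nat \<Rightarrow> real poly" where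
  "interval_prod \<gamma>1 \<gamma>2 h n \<alpha> \<beta> i =
     node_prod \<gamma>1 \<gamma>2 h {i..<n} \<alpha> * node_prod \<gamma>1 \<gamma>2 h {..<i} \<beta>"

text \<open>The two values combined in a step share all nodes but one: \<alpha> - (i + k)h in the
  first, \<beta> - ih in the second. Cramer's rule trades these for the argument that \<sigma>
  supplies.\<close>

lemma hg_eval_blossom:
  assumes adm: "admissible \<gamma>1 \<gamma>2 h n \<alpha> \<beta>"
    and P: "\<And>i. i \<le> n \<Longrightarrow> P i = coeff_functional n c (interval_prod \<gamma>1 \<gamma>2 h n \<alpha> \<beta> i)"
    and "i + k \<le> n"
  shows "hg_eval \<gamma>1 \<gamma>2 h \<alpha> \<beta> \<sigma> P x k i = coeff_functional n c
    ((\<Prod>l=1..k. gamma_factor \<gamma>1 \<gamma>2 (x - (real (\<sigma> l) - 1) * h)) *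
     (node_prod \<gamma>1 \<gamma>2 h {i + k..<n} \<alpha> * node_prod \<gamma>1 \<gamma>2 h {..<i} \<beta>))"
  using assms(3)
proof (induction k arbitrary: i)
  case 0
  then show ?case by (simp add: P interval_prod_def)
next
  case (Suc k)
  let ?y = "x - (real (\<sigma> (k + 1)) - 1) * h"
  let ?X = "\<Prod>l=1..k. gamma_factor \<gamma>1 \<gamma>2 (x - (real (\<sigma> l) - 1) * h)"
  let ?A = "node_prod \<gamma>1 \<gamma>2 h {Suc (i + k)..<n} \<alpha>" and ?B = "node_prod \<gamma>1 \<gamma>2 h {..<i} \<beta>"
  let ?u = "\<alpha> - real (i + k) * h" and ?v = "\<beta> - real i * h"
  let ?d = "dgam \<gamma>1 \<gamma>2"
  \<comment> \<open>Admissibility at the index pair \<open>i \<le> i + k < n\<close>.\<close>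
  have d: "?d ?u ?v \<noteq> 0"
    using adm Suc.prems unfolding admissible_def by (metis Suc_le_lessD add_Suc_right le_add1)
  have A: "node_prod \<gamma>1 \<gamma>2 h {i + k..<n} \<alpha> = gamma_factor \<gamma>1 \<gamma>2 ?u * ?A"
    using Suc.prems unfolding node_prod_def by (subst prod.atLeast_Suc_lessThan) auto
  have B: "node_prod \<gamma>1 \<gamma>2 h {..<Suc i} \<beta> = gamma_factor \<gamma>1 \<gamma>2 ?v * ?B"
    unfolding node_prod_def by (simp add: mult.commute)
  have "(\<Prod>l=1..Suc k. gamma_factor \<gamma>1 \<gamma>2 (x - (real (\<sigma> l) - 1) * h)) * (?A * ?B) =
      smult (?d ?y ?v / ?d ?u ?v) (?X * (gamma_factor \<gamma>1 \<gamma>2 ?u * ?A * ?B)) +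
      smult (?d ?u ?y / ?d ?u ?v) (?X * (?A * (gamma_factor \<gamma>1 \<gamma>2 ?v * ?B)))"
    using gamma_factor_cramer[OF d, of ?y] by (simp add: algebra_simps)
  then show ?case
    using Suc.IH[of i] Suc.IH[of "i + 1"] Suc.prems
    by (simp add: coeff_functional_add coeff_functional_smult A B)
qed

lemma prod_gamma_factor_eq_node_prod:
  "(\<Prod>l=1..k. gamma_factor \<gamma>1 \<gamma>2 (x - (real l - 1) * h)) = node_prod \<gamma>1 \<gamma>2 h {..<k} x"
  unfolding node_prod_def by (rule prod.reindex_bij_witness[of _ Suc "\<lambda>i. i - 1"]) auto

text \<open>The reversed order supplies the shifts (n - 1)h, (n - 2)h, ..., kh: the upper range of
  nodes, as needed at the left endpoint of [t, b].\<close>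

lemma prod_gamma_factor_rev_eq_node_prod:
  assumes "k \<le> n"
  shows "(\<Prod>l=1..n - k. gamma_factor \<gamma>1 \<gamma>2 (x - (real (n + 1 - l) - 1) * h)) =
    node_prod \<gamma>1 \<gamma>2 h {k..<n} x"
  unfolding node_prod_def
  by (rule prod.reindex_bij_witness[of _ "\<lambda>i. n - i" "\<lambda>l. n - l"])
     (use assms in \<open>auto simp: of_nat_diff\<close>)

section \<open>Control points as blossom values\<close>

text \<open>After all n steps no endpoint node is left, so the curve depends on \<open>c\<close>
  alone. This lets different intervals share one \<open>c\<close>.\<close>

lemma blossom_curve_eq_sum_bernstein:
  assumes "admissible \<gamma>1 \<gamma>2 h n \<alpha> \<beta>"
    and "\<And>i. i \<le> n \<Longrightarrow> p i = coeff_functional n c (interval_prod \<gamma>1 \<gamma>2 h n \<alpha> \<beta> i)"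
  shows "(\<Sum>k\<le>n. hg_bernstein \<gamma>1 \<gamma>2 h n \<alpha> \<beta> k x *\<^sub>R p k) =
    coeff_functional n c (node_prod \<gamma>1 \<gamma>2 h {..<n} x)"
proof -
  have "hg_eval \<gamma>1 \<gamma>2 h \<alpha> \<beta> (\<lambda>i. i) p x n 0 = coeff_functional n c
      ((\<Prod>l=1..n. gamma_factor \<gamma>1 \<gamma>2 (x - (real l - 1) * h)) *
       (node_prod \<gamma>1 \<gamma>2 h {0 + n..<n} \<alpha> * node_prod \<gamma>1 \<gamma>2 h {..<0} \<beta>))"
    by (rule hg_eval_blossom) (use assms in auto)
  then show ?thesis
    unfolding prod_gamma_factor_eq_node_prod hg_eval_eq_sum_bernstein
    by (simp add: node_prod_def)
qed

lemma coeff_functional_curve_zero: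
  fixes c :: "nat \<Rightarrow> 'a::euclidean_space"
  assumes "lin_indep_fns {0..n} (Gfun \<gamma>1 \<gamma>2 h n)"
    and "\<And>x. coeff_functional n c (node_prod \<gamma>1 \<gamma>2 h {..<n} x) = 0" and "k \<le> n"
  shows "c k = 0"
  using lin_indep_fns_vector[OF assms(1), of c k] assms(2,3)
  by (simp add: coeff_functional_def coeff_node_prod atMost_atLeast0)

text \<open>The n + 1 conditions on n + 1 coefficients form a square system. Its kernel is trivial:
  zero blossom values are zero control points, so the curve vanishes, and with it
  \<open>c\<close>.\<close>

lemma blossom_interpolation:
  fixes p :: "nat \<Rightarrow> 'a::euclidean_space"
  assumes ind: "lin_indep_fns {0..n} (Gfun \<gamma>1 \<gamma>2 h n)" and adm: "admissible \<gamma>1 \<gamma>2 h n \<alpha> \<beta>"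
  obtains c where "\<And>i. i \<le> n \<Longrightarrow> p i = coeff_functional n c (interval_prod \<gamma>1 \<gamma>2 h n \<alpha> \<beta> i)"
proof -
  have "\<exists>c. \<forall>j\<in>{..n}. (\<Sum>k\<in>{..n}. coeff (interval_prod \<gamma>1 \<gamma>2 h n \<alpha> \<beta> j) k *\<^sub>R c k) = p j"
  proof (rule square_system_solvable)
    fix c :: "nat \<Rightarrow> real"
    assume "\<And>j. j \<in> {..n} \<Longrightarrow> (\<Sum>k\<in>{..n}. coeff (interval_prod \<gamma>1 \<gamma>2 h n \<alpha> \<beta> j) k * c k) = 0"
    then have "coeff_functional n c (node_prod \<gamma>1 \<gamma>2 h {..<n} x) = 0" for x
      using blossom_curve_eq_sum_bernstein[OF adm, of "\<lambda>_. 0" c x]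
      by (simp add: coeff_functional_def)
    then show "\<forall>k\<in>{..n}. c k = 0"
      using coeff_functional_curve_zero[OF ind] by auto
  qed auto
  then obtain c where
    "\<forall>j\<in>{..n}. (\<Sum>k\<in>{..n}. coeff (interval_prod \<gamma>1 \<gamma>2 h n \<alpha> \<beta> j) k *\<^sub>R c k) = p j" ..
  then show ?thesis by (intro that[of c]) (simp add: coeff_functional_def)
qed

text \<open>The \<open>p k\<close> are blossom values of some \<open>c\<close>; the curve vanishes,
  hence so does \<open>c\<close>. This gives uniqueness of control points.\<close>

lemma bernstein_sum_zero:
  fixes p :: "nat \<Rightarrow> 'a::euclidean_space"
  assumes "lin_indep_fns {0..n} (Gfun \<gamma>1 \<gamma>2 h n)" and "admissible \<gamma>1 \<gamma>2 h n \<alpha> \<beta>"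
    and "\<And>x. (\<Sum>k\<le>n. hg_bernstein \<gamma>1 \<gamma>2 h n \<alpha> \<beta> k x *\<^sub>R p k) = 0" and "k \<le> n"
  shows "p k = 0"
proof -
  obtain c where c: "\<And>i. i \<le> n \<Longrightarrow> p i = coeff_functional n c (interval_prod \<gamma>1 \<gamma>2 h n \<alpha> \<beta> i)"
    using blossom_interpolation[OF assms(1,2)] by metis
  have "coeff_functional n c (node_prod \<gamma>1 \<gamma>2 h {..<n} x) = 0" for x
    using blossom_curve_eq_sum_bernstein[OF assms(2) c, of x] assms(3)[of x] by simp
  then have "c k = 0" if "k \<le> n" for k
    using coeff_functional_curve_zero[OF assms(1)] that by blast
  then show ?thesis using c[OF assms(4)] by (simp add: coeff_functional_def)
qed

lemma control_points_iff_blossom: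
  fixes G :: "real \<Rightarrow> 'a::euclidean_space"
  assumes ind: "lin_indep_fns {0..n} (Gfun \<gamma>1 \<gamma>2 h n)" and adm: "admissible \<gamma>1 \<gamma>2 h n \<alpha> \<beta>"
    and G: "\<And>x. G x = coeff_functional n c (node_prod \<gamma>1 \<gamma>2 h {..<n} x)"
  shows "control_points \<gamma>1 \<gamma>2 h n \<alpha> \<beta> G p \<longleftrightarrow>
    (\<forall>k\<le>n. p k = coeff_functional n c (interval_prod \<gamma>1 \<gamma>2 h n \<alpha> \<beta> k))"
proof
  let ?q = "\<lambda>k. coeff_functional n c (interval_prod \<gamma>1 \<gamma>2 h n \<alpha> \<beta> k)"
  assume "control_points \<gamma>1 \<gamma>2 h n \<alpha> \<beta> G p"
  \<comment> \<open>Both \<open>p\<close> and \<open>?q\<close> represent \<open>G\<close>, so their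
    difference represents zero.\<close>
  then have "(\<Sum>k\<le>n. hg_bernstein \<gamma>1 \<gamma>2 h n \<alpha> \<beta> k x *\<^sub>R (p k - ?q k)) = 0" for x
    using blossom_curve_eq_sum_bernstein[OF adm, of ?q c x] G[of x]
    by (simp add: control_points_def scaleR_diff_right sum_subtractf)
  then show "\<forall>k\<le>n. p k = ?q k"
    using bernstein_sum_zero[OF ind adm, of "\<lambda>k. p k - ?q k"] by auto
next
  assume "\<forall>k\<le>n. p k = coeff_functional n c (interval_prod \<gamma>1 \<gamma>2 h n \<alpha> \<beta> k)"
  then show "control_points \<gamma>1 \<gamma>2 h n \<alpha> \<beta> G p"
    using blossom_curve_eq_sum_bernstein[OF adm, of p c] G by (simp add: control_points_def)
qed

theorem proposition5p17:
  fixes n :: nat and h a b t :: real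
    and \<gamma>1 \<gamma>2 :: "real \<Rightarrow> real"
    and G :: "real \<Rightarrow> 'a::euclidean_space" and P :: "nat \<Rightarrow> 'a"
  assumes "n \<ge> 1"
    and "continuous_on UNIV \<gamma>1" and "continuous_on UNIV \<gamma>2"
    and "lin_indep_fns {0, 1::nat} (\<lambda>i. if i = 0 then \<gamma>1 else \<gamma>2)"
    and "translation_invariant \<gamma>1 \<gamma>2"
    and "lin_indep_fns {0..n} (Gfun \<gamma>1 \<gamma>2 h n)"
    and "t \<in> closed_segment a b"
    and "admissible \<gamma>1 \<gamma>2 h n a b"
    and "admissible \<gamma>1 \<gamma>2 h n a t"
    and "admissible \<gamma>1 \<gamma>2 h n t b"
    and "G \<in> pi_space \<gamma>1 \<gamma>2 n"
    and "control_points \<gamma>1 \<gamma>2 h n a b G P"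
  shows "(\<forall>L. control_points \<gamma>1 \<gamma>2 h n a t G L \<longleftrightarrow>
              (\<forall>k\<le>n. L k = hg_eval \<gamma>1 \<gamma>2 h a b (\<lambda>i. i) P t k 0)) \<and>
         (\<forall>R. control_points \<gamma>1 \<gamma>2 h n t b G R \<longleftrightarrow>
              (\<forall>k\<le>n. R k = hg_eval \<gamma>1 \<gamma>2 h a b (\<lambda>i. n + 1 - i) P t (n - k) k))"
proof -
  note ind = assms(6) and adm = assms(8)
  \<comment> \<open>One \<open>c\<close>, found from \<open>P\<close> over [a, b], serves both
    subintervals.\<close>
  obtain c where c: "\<And>i. i \<le> n \<Longrightarrow> P i = coeff_functional n c (interval_prod \<gamma>1 \<gamma>2 h n a b i)"
    using blossom_interpolation[OF ind adm] by metis
  have G: "G x = coeff_functional n c (node_prod \<gamma>1 \<gamma>2 h {..<n} x)" for x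
    using assms(12) blossom_curve_eq_sum_bernstein[OF adm c, of x]
    by (simp add: control_points_def)
  \<comment> \<open>At lower index 0 no node at b enters; k steps replace the first k nodes at a by
    those at t.\<close>
  have L: "hg_eval \<gamma>1 \<gamma>2 h a b (\<lambda>i. i) P t k 0 =
      coeff_functional n c (interval_prod \<gamma>1 \<gamma>2 h n a t k)" if "k \<le> n" for k
    using hg_eval_blossom[OF adm c, of 0 k "\<lambda>i. i" t] that
    unfolding prod_gamma_factor_eq_node_prod interval_prod_def
    by (simp add: node_prod_def mult.commute)
  \<comment> \<open>After n - k steps at index k no node at a is left: the shifts kh, ..., (n - 1)h
    are now at t, the first k remain at b.\<close>
  have R: "hg_eval \<gamma>1 \<gamma>2 h a b (\<lambda>i. n + 1 - i) P t (n - k) k =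
      coeff_functional n c (interval_prod \<gamma>1 \<gamma>2 h n t b k)" if "k \<le> n" for k
    using hg_eval_blossom[OF adm c, of k "n - k" "\<lambda>i. n + 1 - i" t] that
    unfolding prod_gamma_factor_rev_eq_node_prod[OF that] interval_prod_def
    by (simp add: node_prod_def)
  show ?thesis
    using L R control_points_iff_blossom[OF ind assms(9) G]
      control_points_iff_blossom[OF ind assms(10) G] by simp
qed

end
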